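(* Let $q>0$, $a,b>1$ and $x\in(0,1)$ be fixed real numbers. For $p\in(0,\infty)$ define $$\psi(p) = \left(\frac{\Phi_{p,q}(a,b;x)}{(1+a)^p(1+b)^q} - \frac{x}{1-x}\right)\frac{x-1}{px}.$$ Then $\psi$ is completely monotonic as a function of $p$ on $(0,\infty)$.
   Context: The generalized polylogarithm is $$\Phi_{p,q}(a,b;x) = \sum_{k=1}^\infty \frac{(1+a)^p(1+b)^q}{(k+a)^p(k+b)^q} x^k, \qquad |x|<1.$$ A function $f$ is completely monotonic on an interval $I$ if it is infinitely differentiable on $I$ and $(-1)^k f^{(k)}(t)\ge 0$ for every $t\in I$ and every non-negative integer $k$. *)

theory Defs
  imports "HOL-Analysis.Analysis"
begin

text \<open>The series starts at \<open>k = 1\<close>, hence the index shift. The real power is \<open>powr\<close>, so the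
  formula is meant for \<open>a, b > -1\<close> (all bases positive) and \<open>\<bar>x\<bar> < 1\<close>.\<close>

definition gen_polylog :: "real \<Rightarrow> real \<Rightarrow> real \<Rightarrow> real \<Rightarrow> real \<Rightarrow> real" where
  "gen_polylog p q a b x =
    (\<Sum>n. let k = Suc n in
       ((1 + a) powr p * (1 + b) powr q) / ((real k + a) powr p * (real k + b) powr q) * x ^ k)"

text \<open>Iterated derivative relative to \<open>I\<close>: one-sided at an endpoint belonging to \<open>I\<close>, and the
  ordinary derivative at interior points. It is meaningful only when \<open>I\<close> has no isolated points;
  elsewhere \<open>vector_derivative\<close> is an arbitrary choice.\<close>

primrec nth_deriv_within :: "real set \<Rightarrow> nat \<Rightarrow> (real \<Rightarrow> real) \<Rightarrow> real \<Rightarrow> real" where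
  "nth_deriv_within I 0 f = f"
| "nth_deriv_within I (Suc k) f =
    (\<lambda>t. vector_derivative (nth_deriv_within I k f) (at t within I))"

definition infinitely_differentiable_on :: "(real \<Rightarrow> real) \<Rightarrow> real set \<Rightarrow> bool" where
  "infinitely_differentiable_on f I \<longleftrightarrow> (\<forall>k. nth_deriv_within I k f differentiable_on I)"

definition completely_monotonic_on :: "(real \<Rightarrow> real) \<Rightarrow> real set \<Rightarrow> bool" where
  "completely_monotonic_on f I \<longleftrightarrow>
    infinitely_differentiable_on f I \<and>
    (\<forall>t\<in>I. \<forall>k. (-1) ^ k * nth_deriv_within I k f t \<ge> 0)"

end

theory Submission
  imports Defs
begin

text \<open>
  With the factor \<open>(1 - x) / x\<close> absorbed into the weights, \<open>\<psi>\<close> has the shape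
  \<open>(A - (\<Sum>k. w\<^sub>k exp (- L\<^sub>k p))) / p\<close> with \<open>w\<^sub>k, L\<^sub>k \<ge> 0\<close> and \<open>(\<Sum>k. w\<^sub>k) \<le> A\<close>.
  Let \<open>e\<^sub>n(y)\<close> be the Poisson distribution function \<open>exp (- y) (\<Sum>j\<le>n. y ^ j / j!)\<close>. By Leibniz' rule the \<open>n\<close>-th
  derivative is \<open>(-1) ^ n n! / p ^ (n + 1) (A - (\<Sum>k. w\<^sub>k e\<^sub>n(L\<^sub>k p)))\<close>, and the last factor is
  nonnegative because \<open>e\<^sub>n \<le> 1\<close>. Termwise differentiation is dominated by \<open>w\<^sub>k L\<^sub>k\<close>,
  because \<open>exp (- y) y ^ n / n! \<le> 1\<close>.
\<close>

text \<open>Since \<open>vector_derivative\<close> is a choice operator, the iterates are identified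
  with an explicit candidate family \<open>D\<close>. On an open set the derivative within
  \<open>I\<close> is the ordinary one, and it depends only on values near the point, so agreement
  on \<open>I\<close> passes from order \<open>n\<close> to order \<open>Suc n\<close>.\<close>

lemma completely_monotonic_onI:
  assumes "open I"
    and f0: "\<And>t. t \<in> I \<Longrightarrow> D 0 t = f t"
    and D: "\<And>n t. t \<in> I \<Longrightarrow> (D n has_real_derivative D (Suc n) t) (at t)"
    and sgn: "\<And>n t. t \<in> I \<Longrightarrow> (-1) ^ n * D n t \<ge> 0"
  shows "completely_monotonic_on f I"
proof -
  have *: "(nth_deriv_within I n f has_real_derivative D (Suc n) t) (at t)"
    if "\<forall>s\<in>I. nth_deriv_within I n f s = D n s" "t \<in> I" for n t
    using has_field_derivative_transform_within_open[OF D[OF that(2)] \<open>open I\<close> that(2)] that(1)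
    by simp
  have eq: "\<forall>t\<in>I. nth_deriv_within I n f t = D n t" for n
  proof (induction n)
    case (Suc n)
    have "nth_deriv_within I (Suc n) f t = D (Suc n) t" if "t \<in> I" for t
      using vector_derivative_at[of "nth_deriv_within I n f" "D (Suc n) t" t]
        *[OF Suc that] at_within_open[OF that \<open>open I\<close>]
      by (simp add: has_real_derivative_iff_has_vector_derivative)
    then show ?case by blast
  qed (simp add: f0)
  have "nth_deriv_within I n f differentiable_on I" for n
    using *[OF eq] unfolding differentiable_on_def
    by (meson differentiable_at_withinI real_differentiable_def)
  then show ?thesis
    using eq sgn by (simp add: completely_monotonic_on_def infinitely_differentiable_on_def)
qed

section \<open>Poisson distribution functions\<close>

definition poisson_cdf :: "nat \<Rightarrow> real \<Rightarrow> real" where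
  "poisson_cdf n y = exp (- y) * (\<Sum>j\<le>n. y ^ j / fact j)"

lemma poisson_cdf_0: "poisson_cdf 0 y = exp (- y)"
  by (simp add: poisson_cdf_def)

lemma poisson_cdf_Suc:
  "poisson_cdf (Suc n) y = poisson_cdf n y + exp (- y) * y ^ Suc n / fact (Suc n)"
  by (simp add: poisson_cdf_def algebra_simps)

lemma poisson_cdf_nonneg: "y \<ge> 0 \<Longrightarrow> poisson_cdf n y \<ge> 0"
  unfolding poisson_cdf_def by (intro mult_nonneg_nonneg sum_nonneg) auto

lemma poisson_cdf_le_1:
  assumes "y \<ge> 0"
  shows "poisson_cdf n y \<le> 1"
proof -
  have "(\<lambda>j. y ^ j / fact j) sums exp y"
    using exp_converges[of y] by (simp add: field_simps)
  then have "(\<Sum>j\<le>n. y ^ j / fact j) \<le> exp y"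
    using sum_le_suminf[of "\<lambda>j. y ^ j / fact j" "{..n}"] assms
    by (auto simp: sums_iff)
  then show ?thesis
    by (simp add: poisson_cdf_def exp_minus field_simps)
qed

lemma poisson_weight_le_1:
  fixes y :: real
  assumes "y \<ge> 0"
  shows "exp (- y) * y ^ n / fact n \<le> 1"
proof -
  have "y ^ n / fact n \<le> (\<Sum>j\<le>n. y ^ j / fact j)"
    using assms by (intro member_le_sum[of n "{..n}"]) auto
  then have "exp (- y) * (y ^ n / fact n) \<le> poisson_cdf n y"
    unfolding poisson_cdf_def by (rule mult_left_mono) simp
  then show ?thesis
    using poisson_cdf_le_1[OF assms, of n] by (simp only: times_divide_eq_right)
qed

text \<open>The sum telescopes: each Poisson weight has as derivative the preceding weight minus
  itself, so only the last weight survives, with a minus sign.\<close>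

lemma has_field_derivative_poisson_cdf:
  "(poisson_cdf n has_real_derivative - (exp (- y) * y ^ n / fact n)) (at y)"
proof (induction n)
  case 0
  have "((\<lambda>y. exp (- y)) has_real_derivative - exp (- y)) (at y)"
    by (auto intro!: derivative_eq_intros)
  then show ?case
    by (simp add: poisson_cdf_0[abs_def])
next
  case (Suc n)
  have "((\<lambda>y. exp (- y) * y ^ Suc n) has_real_derivative
      real (Suc n) * (exp (- y) * y ^ n) - exp (- y) * y ^ Suc n) (at y)"
    by (auto intro!: derivative_eq_intros simp del: power_Suc)
  from DERIV_cdivide[OF this, of "fact (Suc n)"]
  have "((\<lambda>y. exp (- y) * y ^ Suc n / fact (Suc n)) has_real_derivative
      exp (- y) * y ^ n / fact n - exp (- y) * y ^ Suc n / fact (Suc n)) (at y)"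
    unfolding fact_Suc diff_divide_distrib of_nat_mult of_nat_fact by (simp del: of_nat_Suc)
  from DERIV_add[OF Suc this] show ?case
    by (simp add: poisson_cdf_Suc[abs_def])
qed

section \<open>Series of Poisson distribution functions\<close>

lemma summable_poisson_cdf:
  assumes "\<And>k. w k \<ge> (0::real)" and "summable w" and "\<And>k. y k \<ge> 0"
  shows "summable (\<lambda>k. w k * poisson_cdf n (y k))"
  by (rule summable_comparison_test'[OF assms(2)])
    (use assms poisson_cdf_nonneg poisson_cdf_le_1 in \<open>auto simp: abs_mult mult_left_le\<close>)

lemma suminf_poisson_cdf_le:
  assumes "\<And>k. w k \<ge> (0::real)" and "summable w" and "\<And>k. y k \<ge> 0"
  shows "(\<Sum>k. w k * poisson_cdf n (y k)) \<le> (\<Sum>k. w k)"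
  by (rule suminf_le[OF _ summable_poisson_cdf])
    (use assms poisson_cdf_le_1 in \<open>auto simp: mult_left_le\<close>)

text \<open>The chain rule brings out a factor \<open>L k\<close>, and the remaining Poisson weight
  is at most 1. Hence \<open>w k * L k\<close> is a majorant independent of \<open>p\<close>, and
  the Weierstrass test applies on the whole half-line.\<close>

lemma
  fixes w L :: "nat \<Rightarrow> real"
  assumes w: "\<And>k. w k \<ge> 0" "summable w"
    and L: "\<And>k. L k \<ge> 0" "summable (\<lambda>k. w k * L k)"
    and p: "p > 0"
  shows summable_poisson_weight:
      "summable (\<lambda>k. w k * L k * (exp (- (L k * p)) * (L k * p) ^ n / fact n))" (is ?S)
    and has_field_derivative_suminf_poisson_cdf:
      "((\<lambda>p. \<Sum>k. w k * poisson_cdf n (L k * p)) has_real_derivative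
        - (\<Sum>k. w k * L k * (exp (- (L k * p)) * (L k * p) ^ n / fact n))) (at p)" (is ?D)
proof -
  define g where "g k p = w k * L k * (exp (- (L k * p)) * (L k * p) ^ n / fact n)" for k p
  have g: "norm (g k p) \<le> w k * L k" if "p > 0" for k p
    using mult_left_le[OF poisson_weight_le_1[of "L k * p" n], of "w k * L k"]
      that w(1)[of k] L(1)[of k]
    by (simp add: g_def)
  have sg: "summable (\<lambda>k. g k p)" if "p > 0" for p
    by (rule summable_comparison_test'[OF L(2)]) (use g that in auto)
  show ?S using sg[OF p] by (simp add: g_def)
  have ul: "uniformly_convergent_on {0<..} (\<lambda>m p. \<Sum>k<m. - g k p)"
    by (rule Weierstrass_m_test'[OF _ L(2)]) (use g in auto)
  have der: "((\<lambda>p. w k * poisson_cdf n (L k * p)) has_real_derivative - g k p)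
      (at p within {0<..})" for k p
    by (rule DERIV_subset[of _ _ _ UNIV],
        rule derivative_eq_intros DERIV_chain2[OF has_field_derivative_poisson_cdf] refl
          | simp add: g_def)+
  have "((\<lambda>p. \<Sum>k. w k * poisson_cdf n (L k * p)) has_real_derivative (\<Sum>k. - g k p)) (at p)"
    \<comment> \<open>The \<open>1\<close> is a sample point of the half-line at which the
      undifferentiated series has to converge.\<close>
    by (rule has_field_derivative_series'(2)[OF _ der ul, of 1])
      (use p summable_poisson_cdf w L in \<open>auto simp: interior_open\<close>)
  then show ?D
    using suminf_minus[OF sg[OF p]] by (simp add: g_def)
qed

lemma completely_monotonic_on_dirichlet_quotient:
  fixes w L :: "nat \<Rightarrow> real"
  assumes w: "\<And>k. w k \<ge> 0" "summable w"
    and L: "\<And>k. L k \<ge> 0" "summable (\<lambda>k. w k * L k)"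
    and A: "(\<Sum>k. w k) \<le> A"
    and f: "\<And>p. p > 0 \<Longrightarrow> f p = (A - (\<Sum>k. w k * exp (- (L k * p)))) / p"
  shows "completely_monotonic_on f {0<..}"
proof -
  define H where "H n p = (\<Sum>k. w k * poisson_cdf n (L k * p))" for n p
  define D where "D n p = (-1) ^ n * fact n / p ^ Suc n * (A - H n p)" for n p
  define T where "T n p = (\<Sum>k. w k * L k * (exp (- (L k * p)) * (L k * p) ^ n / fact n))" for n p
  \<comment> \<open>This recursion closes the induction on derivatives. As \<open>H n\<close> has
    derivative \<open>- T n\<close>, differentiating \<open>(A - H n p) / p ^ Suc n\<close> gives
    \<open>- Suc n / p ^ Suc (Suc n)\<close> times \<open>A - H n p - p / Suc n * T n p\<close>, and
    the latter is \<open>A - H (Suc n) p\<close>.\<close>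
  have H_Suc: "H (Suc n) p = H n p + p / Suc n * T n p" if p: "p > 0" for n p
  proof -
    have "H (Suc n) p = (\<Sum>k. w k * poisson_cdf n (L k * p)
        + p / Suc n * (w k * L k * (exp (- (L k * p)) * (L k * p) ^ n / fact n)))"
      unfolding H_def
    proof (intro suminf_cong)
      fix k
      show "w k * poisson_cdf (Suc n) (L k * p) = w k * poisson_cdf n (L k * p)
          + p / Suc n * (w k * L k * (exp (- (L k * p)) * (L k * p) ^ n / fact n))"
        unfolding poisson_cdf_Suc by (simp add: divide_simps) (simp add: algebra_simps)
    qed
    also have "\<dots> = H n p + p / Suc n * T n p"
      using summable_poisson_weight[OF w L p, of n]
        summable_poisson_cdf[OF w, of "\<lambda>k. L k * p" n] L(1) p
      unfolding H_def T_def
      by (subst suminf_add[symmetric]) (auto simp only: suminf_mult summable_mult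
          zero_le_mult_iff less_imp_le)
    finally show ?thesis .
  qed
  show ?thesis
  proof (rule completely_monotonic_onI[where D = D])
    show "D 0 t = f t" if "t \<in> {0<..}" for t
      using that by (simp add: D_def H_def poisson_cdf_0 f)
    fix n and t :: real
    assume "t \<in> {0<..}"
    then have t: "t > 0" by simp
    have "(H n has_real_derivative - T n t) (at t)"
      unfolding H_def[abs_def] T_def
      by (rule has_field_derivative_suminf_poisson_cdf[OF w L t])
    then have AH: "((\<lambda>p. A - H n p) has_real_derivative 0 - (- T n t)) (at t)"
      by (intro DERIV_diff DERIV_const)
    have "((\<lambda>p. p ^ Suc n) has_real_derivative real (Suc n) * t ^ n) (at t)"
      using DERIV_pow[of "Suc n" t] by simp
    from DERIV_divide[OF DERIV_const this, of "(-1) ^ n * fact n"]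
    have "((\<lambda>p. (-1) ^ n * fact n / p ^ Suc n) has_real_derivative
        (-1) ^ Suc n * fact (Suc n) / t ^ Suc (Suc n)) (at t)"
      using t by (auto elim!: DERIV_cong simp: field_simps)
    from DERIV_mult[OF this AH]
    show "(D n has_real_derivative D (Suc n) t) (at t)"
      unfolding D_def[abs_def] H_Suc[OF t]
      by (rule DERIV_cong) (use t in \<open>simp add: divide_simps, simp add: algebra_simps\<close>)
    have "H n t \<le> A"
      using suminf_poisson_cdf_le[OF w, of "\<lambda>k. L k * t" n] A L(1) t
      by (simp add: H_def)
    moreover have "(-1) ^ n * D n t = fact n / t ^ Suc n * (A - H n t)"
      by (simp add: D_def flip: power_mult_distrib mult.assoc)
    ultimately show "(-1) ^ n * D n t \<ge> 0"
      using t by simp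
  qed simp
qed

section \<open>Application to the generalized polylogarithm\<close>

lemma summable_power_mult_linear:
  fixes x c :: real
  assumes "0 < x" "x < 1"
  shows "summable (\<lambda>n. x ^ n * (real n + c))"
proof -
  \<comment> \<open>The termwise derivative of the geometric series minus the geometric series
    itself.\<close>
  have "summable (\<lambda>n. real n * x ^ n)"
    using sums_summable[OF geometric_deriv_sums[of x]] summable_geometric[of x] assms
      summable_diff[of "\<lambda>n. real (Suc n) * x ^ n" "\<lambda>n. x ^ n"]
    by (simp add: algebra_simps)
  then have "summable (\<lambda>n. real n * x ^ n + c * x ^ n)"
    using assms by (intro summable_add summable_mult summable_geometric) auto
  then show ?thesis
    by (simp add: algebra_simps)
qed

theorem corollary3p3:
  fixes q a b x :: real
  assumes "q > 0" and "a > 1" and "b > 1" and "0 < x" and "x < 1"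
  shows "completely_monotonic_on
    (\<lambda>p. (gen_polylog p q a b x / ((1 + a) powr p * (1 + b) powr q) - x / (1 - x))
          * ((x - 1) / (p * x)))
    {0<..}"
proof -
  \<comment> \<open>Index \<open>n\<close> stands for \<open>k = Suc n\<close>, but the power is
    \<open>x ^ n\<close>: the missing factor \<open>x\<close> is restored in \<open>x * S\<close>
    below and cancels against the prefactor of \<psi>. The factor \<open>1 - x\<close> in
    \<open>w\<close> makes the dominating geometric series sum to 1, the constant \<open>A\<close>
    of the quotient.\<close>
  define v where "v n = x ^ n / (real (Suc n) + b) powr q" for n
  define w where "w n = (1 - x) * v n" for n
  define L where "L n = ln (real (Suc n) + a)" for n
  have geo: "(\<lambda>n. (1 - x) * x ^ n) sums 1"
    using sums_mult[OF geometric_sums[of x], of "1 - x"] assms by simp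
  have w0: "w n \<ge> 0" and L0: "L n \<ge> 0" for n
    using assms by (auto simp: w_def v_def L_def)
  \<comment> \<open>The base \<open>real (Suc n) + b\<close> exceeds 1 and \<open>q\<close> is
    positive, so the denominator is at least 1.\<close>
  have v_le: "v n \<le> x ^ n" for n
    using assms ge_one_powr_ge_zero[of "real (Suc n) + b" q]
    by (simp add: v_def divide_le_eq mult_left_le field_simps)
  have w_le: "w n \<le> (1 - x) * x ^ n" for n
    using v_le assms by (simp add: w_def)
  have sv: "summable v"
    by (rule summable_comparison_test'[of "\<lambda>n. x ^ n"])
      (use assms v_le in \<open>auto simp: v_def\<close>)
  then have sw: "summable w"
    unfolding w_def by (rule summable_mult)
  have sum_w: "(\<Sum>n. w n) \<le> 1"
    using suminf_le[OF w_le sw sums_summable[OF geo]] sums_unique[OF geo] by simp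
  have swL: "summable (\<lambda>n. w n * L n)"
  proof (rule summable_comparison_test')
    show "summable (\<lambda>n. x ^ n * (real n + a))"
      using summable_power_mult_linear assms by blast
    fix n :: nat
    \<comment> \<open>The bound \<open>ln y \<le> y - 1\<close> absorbs the 1 from
      \<open>Suc n\<close>; linear growth of \<open>L\<close> suffices against geometric
      decay.\<close>
    have "L n \<le> real n + a"
      using ln_le_minus_one[of "real (Suc n) + a"] assms by (simp add: L_def)
    moreover have "w n \<le> x ^ n"
      using w_le[of n] assms by (smt (verit) mult_left_le_one_le zero_le_power)
    ultimately show "norm (w n * L n) \<le> x ^ n * (real n + a)"
      using w0 L0 assms by (simp add: mult_mono)
  qed
  have "(gen_polylog p q a b x / ((1 + a) powr p * (1 + b) powr q) - x / (1 - x))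
      * ((x - 1) / (p * x)) = (1 - (\<Sum>n. w n * exp (- (L n * p)))) / p" if p: "p > 0" for p
  proof -
    define c where "c = (1 + a) powr p * (1 + b) powr q"
    have c: "c > 0"
      using assms by (simp add: c_def)
    define S where "S = (\<Sum>n. v n * exp (- (L n * p)))"
    have sS: "summable (\<lambda>n. v n * exp (- (L n * p)))"
      by (rule summable_comparison_test'[OF sv])
        (use assms p L0 in \<open>auto simp: v_def intro!: divide_right_mono mult_left_le\<close>)
    \<comment> \<open>The normalisation \<open>c\<close> comes out of every term, and
      \<open>(k + a) powr (- p)\<close> becomes \<open>exp (- (L n * p))\<close>.\<close>
    have "gen_polylog p q a b x = (\<Sum>n. c * x * (v n * exp (- (L n * p))))"
      unfolding gen_polylog_def Let_def c_def[symmetric]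
      using assms
      by (intro suminf_cong) (simp add: v_def L_def powr_def exp_minus field_simps)
    also have "\<dots> = c * x * S"
      unfolding S_def by (rule suminf_mult[OF sS])
    finally have "gen_polylog p q a b x / c = x * S"
      using c by simp
    moreover have "(\<Sum>n. w n * exp (- (L n * p))) = (1 - x) * S"
      unfolding S_def w_def suminf_mult[OF sS, symmetric] by (simp add: mult.assoc)
    moreover have "(x * S - x / (1 - x)) * ((x - 1) / (p * x)) = (1 - (1 - x) * S) / p"
      using assms p by (simp add: divide_simps) (simp add: algebra_simps)
    ultimately show ?thesis
      by (simp add: c_def[symmetric])
  qed
  then show ?thesis
    by (rule completely_monotonic_on_dirichlet_quotient[OF w0 sw L0 swL sum_w])
qed

end
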